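(* Let $d\ge1$, $\Psi\in\mathcal B_0$, and let $\mathcal D$ be either $\mathbb R^d$ or a bounded convex open subset of $\mathbb R^d$. Let $V$ be a convex increasing function attaining a global minimum at a point $\hat x\in\mathcal D$. Let $\lambda$ and $\varphi\not\equiv0$ be a pair solving the eigenvalue equation $(\Psi(-\Delta)+V)\varphi=\lambda\varphi$ in $L^2(\mathbb R^d)$ if $\mathcal D=\mathbb R^d$, respectively the Dirichlet problem $(\Psi(-\Delta)+V)\varphi=\lambda\varphi$ in $\mathcal D$, $\varphi=0$ in $\mathcal D^c$, if $\mathcal D$ is bounded, and such that $\lim_{x\to z}\varphi(x)=0$ for every $z\in\partial\mathcal D$. Let $x^*$ be the location of a global maximum of $|\varphi|$, and consider the set $$\mathscr U_\lambda=\{x\in\mathcal D:\ V(x)\le\lambda\}.$$ Then $x^*\in\mathscr U_\lambda$, and hence $$\operatorname{dist}(x^*,\hat x)\ \le\ \max_{z\in\partial\mathscr U_\lambda}\operatorname{dist}(x^*,z).$$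
   Context: $\mathcal B_0$ is the set of Bernstein functions vanishing at zero: $f\in C^\infty((0,\infty))$, $f\ge0$, $(-1)^n f^{(n)}\le 0$ for all $n\ge1$, and $\lim_{u\downarrow0}f(u)=0$. $\Psi(-\Delta)$ is the operator with Fourier multiplier $\Psi(|y|^2)$. Let $(S^\Psi_t)_{t\ge0}$ be the subordinator with $\mathbb E[e^{-uS^\Psi_t}]=e^{-t\Psi(u)}$, $(B_t)_{t\ge0}$ an independent $d$-dimensional Brownian motion running twice as fast as standard Brownian motion, and $X_t=B_{S^\Psi_t}$; $\mathbb E^x$ is expectation for $X$ started at $x$; $\tau_{\mathcal D}=\inf\{t>0: X_t\notin\mathcal D\}$ ($=\infty$ if $\mathcal D=\mathbb R^d$). "Increasing" is meant in the non-strict sense of non-decreasing along rays emanating from $\hat x$, which for a convex function with a global minimum at $\hat x$ holds automatically. Solutions of the eigenvalue problems are understood as bounded continuous functions $\varphi\in L^2(\mathcal D)$ (extended by $0$ outside $\mathcal D$) satisfying the Feynman-Kac representation $\varphi(x)=e^{\lambda t}\,\mathbb E^x\big[e^{-\int_0^tV(X_s)ds}\varphi(X_t)\mathbf 1_{\{\tau_{\mathcal D}>t\}}\big]$ for all $x\in\mathcal D$, $t\ge0$.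
   Formalization: The distance bound is proved only when U_λ is bounded (automatic for bounded D); otherwise it can fail: for Ψ=0, V=0, λ=0 on R^d any bump φ qualifies, but U_λ=R^d has empty boundary and the max does not exist. *)

theory Defs
  imports "HOL-Probability.Probability"
begin

text \<open>Bernstein functions vanishing at zero; only the values on the open half-line matter.\<close>

definition bernstein0 :: "(real \<Rightarrow> real) \<Rightarrow> bool" where
  "bernstein0 \<Psi> \<longleftrightarrow>
     (\<forall>n. \<forall>u>0. (deriv ^^ n) \<Psi> differentiable (at u)) \<and>
     (\<forall>u>0. 0 \<le> \<Psi> u) \<and>
     (\<forall>n\<ge>1. \<forall>u>0. (- 1) ^ n * (deriv ^^ n) \<Psi> u \<le> 0) \<and>
     (\<Psi> \<longlongrightarrow> 0) (at_right 0)"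

text \<open>Processes are indexed by \<open>real\<close>; only nonnegative times are used.\<close>

definition indep_increments ::
  "'w measure \<Rightarrow> (real \<Rightarrow> 'w \<Rightarrow> 'a::euclidean_space) \<Rightarrow> bool" where
  "indep_increments M X \<longleftrightarrow>
     (\<forall>(t :: nat \<Rightarrow> real) n. 0 \<le> t 0 \<longrightarrow> mono t \<longrightarrow>
        prob_space.indep_vars M (\<lambda>_. borel) (\<lambda>i \<omega>. X (t (Suc i)) \<omega> - X (t i) \<omega>) {..<n})"

definition subordinator :: "'w measure \<Rightarrow> (real \<Rightarrow> real) \<Rightarrow> (real \<Rightarrow> 'w \<Rightarrow> real) \<Rightarrow> bool" where
  "subordinator M \<Psi> S \<longleftrightarrow>
     prob_space M \<and>
     (\<forall>t\<ge>0. S t \<in> borel_measurable M) \<and>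
     (AE \<omega> in M. S 0 \<omega> = 0) \<and>
     (AE \<omega> in M. mono_on {0..} (\<lambda>t. S t \<omega>)) \<and>
     (AE \<omega> in M. \<forall>t\<ge>0. ((\<lambda>s. S s \<omega>) \<longlongrightarrow> S t \<omega>) (at_right t)) \<and>
     indep_increments M S \<and>
     (\<forall>s\<ge>0. \<forall>h\<ge>0. distr M borel (\<lambda>\<omega>. S (s + h) \<omega> - S s \<omega>) = distr M borel (S h)) \<and>
     (\<forall>t\<ge>0. \<forall>u>0. (LINT \<omega>|M. exp (- u * S t \<omega>)) = exp (- t * \<Psi> u))"

text \<open>
  Brownian motion started at the origin and run at twice the standard speed: an increment over
  a time interval of length \<open>h\<close> has covariance matrix \<open>2 h\<close> times the identity, so that the
  generator is the Laplacian itself and not one half of it.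
\<close>

definition double_speed_BM :: "'w measure \<Rightarrow> (real \<Rightarrow> 'w \<Rightarrow> 'a::euclidean_space) \<Rightarrow> bool" where
  "double_speed_BM M B \<longleftrightarrow>
     prob_space M \<and>
     (\<forall>t\<ge>0. B t \<in> borel_measurable M) \<and>
     (AE \<omega> in M. B 0 \<omega> = 0) \<and>
     (AE \<omega> in M. continuous_on {0..} (\<lambda>t. B t \<omega>)) \<and>
     indep_increments M B \<and>
     (\<forall>s\<ge>0. \<forall>h>0. distributed M lborel (\<lambda>\<omega>. B (s + h) \<omega> - B s \<omega>)
        (\<lambda>y. ennreal (exp (- (norm y)\<^sup>2 / (4 * h)) / (4 * pi * h) powr (DIM('a) / 2))))"

definition indep_processes ::
  "'w measure \<Rightarrow> (real \<Rightarrow> 'w \<Rightarrow> real) \<Rightarrow> (real \<Rightarrow> 'w \<Rightarrow> 'a::euclidean_space) \<Rightarrow> bool" where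
  "indep_processes M S B \<longleftrightarrow>
     prob_space.indep_set M
       (sets (vimage_algebra (space M) (\<lambda>\<omega>. \<lambda>t\<in>{0..}. S t \<omega>) (PiM {0..} (\<lambda>_. borel))))
       (sets (vimage_algebra (space M) (\<lambda>\<omega>. \<lambda>t\<in>{0..}. B t \<omega>) (PiM {0..} (\<lambda>_. borel))))"

text \<open>
  The path, started at \<open>x\<close>, of the subordinate Brownian motion; expectation for the process
  started at \<open>x\<close> is realised as expectation of functionals of this path.
\<close>

definition sub_path ::
  "(real \<Rightarrow> 'w \<Rightarrow> real) \<Rightarrow> (real \<Rightarrow> 'w \<Rightarrow> 'a::euclidean_space) \<Rightarrow> 'a \<Rightarrow> 'w \<Rightarrow> real \<Rightarrow> 'a" where
  "sub_path S B x \<omega> t = x + B (S t \<omega>) \<omega>"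

definition exit_time :: "'a set \<Rightarrow> (real \<Rightarrow> 'a) \<Rightarrow> ereal" where
  "exit_time D w = Inf (ereal ` {t. 0 < t \<and> w t \<notin> D})"

text \<open>
  The factor \<open>exp (- \<integral>\<^sub>0\<^sup>t V (w s) ds)\<close>.  It is only used for potentials bounded below and paths
  remaining in \<open>D\<close>, where non-integrability means that the integral is \<open>\<infinity>\<close> (possible if \<open>V\<close>
  blows up at the boundary of \<open>D\<close>), hence the value \<open>0\<close>.
\<close>

definition killing_factor :: "('a \<Rightarrow> real) \<Rightarrow> (real \<Rightarrow> 'a) \<Rightarrow> real \<Rightarrow> real" where
  "killing_factor V w t =
     (if set_integrable lborel {0..t} (\<lambda>s. V (w s))
      then exp (- (LBINT s:{0..t}. V (w s))) else 0)"

text \<open>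
  Solutions of the eigenvalue problem for \<open>\<Psi>(-\<Delta>) + V\<close> on \<open>D\<close>, in the Feynman-Kac sense; the
  Bernstein function enters through the law of \<open>S\<close>.  The expectation is taken in the completion
  of \<open>M\<close>, because the event that the exit time exceeds \<open>t\<close> is in general measurable only there.
\<close>

definition FK_eigenpair ::
  "'w measure \<Rightarrow> (real \<Rightarrow> 'w \<Rightarrow> real) \<Rightarrow> (real \<Rightarrow> 'w \<Rightarrow> 'a::euclidean_space) \<Rightarrow>
   'a set \<Rightarrow> ('a \<Rightarrow> real) \<Rightarrow> real \<Rightarrow> ('a \<Rightarrow> real) \<Rightarrow> bool" where
  "FK_eigenpair M S B D V lam \<phi> \<longleftrightarrow>
     bounded (range \<phi>) \<and>
     continuous_on D \<phi> \<and>
     set_integrable lborel D (\<lambda>x. (\<phi> x)\<^sup>2) \<and>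
     (\<forall>x. x \<notin> D \<longrightarrow> \<phi> x = 0) \<and>
     (\<forall>x\<in>D. \<forall>t\<ge>0. \<phi> x = exp (lam * t) *
        (LINT \<omega>|completion M. killing_factor V (sub_path S B x \<omega>) t * \<phi> (sub_path S B x \<omega> t) *
           indicator {\<omega>. ereal t < exit_time D (sub_path S B x \<omega>)} \<omega>))"

text \<open>Non-strict monotonicity along the rays emanating from \<open>c\<close>.\<close>

definition ray_increasing_on :: "'a::real_vector set \<Rightarrow> 'a \<Rightarrow> ('a \<Rightarrow> real) \<Rightarrow> bool" where
  "ray_increasing_on D c V \<longleftrightarrow>
     (\<forall>v r s. 0 \<le> r \<longrightarrow> r \<le> s \<longrightarrow> c + r *\<^sub>R v \<in> D \<longrightarrow> c + s *\<^sub>R v \<in> D \<longrightarrow>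
        V (c + r *\<^sub>R v) \<le> V (c + s *\<^sub>R v))"

definition sublevel :: "'a set \<Rightarrow> ('a \<Rightarrow> real) \<Rightarrow> real \<Rightarrow> 'a set" where
  "sublevel D V c = {x \<in> D. V x \<le> c}"

end

theory Submission
  imports Defs
begin

text \<open>
  Since \<open>\<bar>\<phi>\<bar>\<close> is maximal at \<open>x\<^sup>*\<close>, the Feynman-Kac formula at \<open>x\<^sup>*\<close> gives
  that \<open>exp (\<integral>\<^sub>0\<^sup>t (\<lambda> - V (X s)) ds)\<close>, restricted to the paths staying in \<open>D\<close>, has expectation at least 1.
  If \<open>V x\<^sup>* > \<lambda>\<close>, then, by right-continuity of the paths at time \<open>0\<close>, the difference quotients
  \<open>(exp (\<integral>\<^sub>0\<^sup>t (\<lambda> - V (X s)) ds) - 1) / t\<close> are almost surely eventually below a fixed negative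
  constant as \<open>t\<close> decreases to \<open>0\<close>, while they are bounded above because \<open>V\<close> is bounded below.
  Dominated convergence then makes their expectation negative for small \<open>t\<close>, a contradiction.
  The distance bound follows because the ray from \<open>x\<^sup>*\<close> through the minimiser of \<open>V\<close> meets the
  frontier of the sublevel set beyond the minimiser.
\<close>

lemma killing_factor_nonneg: "0 \<le> killing_factor V w t"
  by (simp add: killing_factor_def)

text \<open>Integrate the lower bound \<open>c\<close> over \<open>{0..t}\<close>; if
  \<open>V\<close> is not integrable along the path, the factor is 0 by definition. The bound is
  required only at positive times because survival up to \<open>t\<close> says nothing about the
  position at time 0.\<close>

lemma killing_factor_le:
  assumes "0 \<le> t" and le: "\<And>s. 0 < s \<Longrightarrow> s \<le> t \<Longrightarrow> c \<le> V (w s)"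
  shows "killing_factor V w t \<le> exp (- c * t)"
proof (cases "set_integrable lborel {0..t} (\<lambda>s. V (w s))")
  case True
  have "c * t = (LBINT s:{0..t}. c)"
    using \<open>0 \<le> t\<close> by (simp add: set_lebesgue_integral_def)
  also have "\<dots> \<le> (LBINT s:{0..t}. V (w s))"
    unfolding set_lebesgue_integral_def
  proof (rule integral_mono_AE)
    show "integrable lborel (\<lambda>s. indicat_real {0..t} s *\<^sub>R c)"
      by (intro integrable_real_indicator integrable_scaleR_left)
        (auto simp: emeasure_lborel_Icc_eq)
    show "integrable lborel (\<lambda>s. indicat_real {0..t} s *\<^sub>R V (w s))"
      using True by (simp add: set_integrable_def)
    \<comment> \<open>The hypothesis is silent at \<open>s = 0\<close>, which is a null set.\<close>
    have "AE s in lborel. s \<noteq> (0::real)"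
      by (rule AE_lborel_singleton)
    then show "AE s in lborel. indicat_real {0..t} s *\<^sub>R c \<le> indicat_real {0..t} s *\<^sub>R V (w s)"
      by eventually_elim (auto simp: indicator_def intro: le)
  qed
  finally show ?thesis
    using True by (simp add: killing_factor_def)
next
  case False
  then show ?thesis
    by (simp add: killing_factor_def)
qed

lemma less_exit_time_imp_mem:
  assumes "ereal t < exit_time D w" "0 < s" "s \<le> t"
  shows "w s \<in> D"
proof (rule ccontr)
  assume "w s \<notin> D"
  then have "exit_time D w \<le> ereal s"
    unfolding exit_time_def using \<open>0 < s\<close> by (intro Inf_lower) auto
  also have "\<dots> \<le> ereal t"
    using \<open>s \<le> t\<close> by simp
  finally show False
    using assms(1) by simp
qed

text \<open>Compose right-continuity of \<open>S\<close> at 0 with continuity of \<open>B\<close> at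
  0. Monotonicity keeps \<open>S\<close> in \<open>{0..}\<close>, the only region where
  \<open>B\<close> is known to be continuous.\<close>

lemma AE_sub_path_tendsto:
  assumes S: "subordinator M \<Psi> S" and B: "double_speed_BM M B"
  shows "AE \<omega> in M. (sub_path S B x \<omega> \<longlongrightarrow> x) (at_right 0)"
proof -
  have "AE \<omega> in M. S 0 \<omega> = 0" "AE \<omega> in M. mono_on {0..} (\<lambda>t. S t \<omega>)"
    "AE \<omega> in M. \<forall>t\<ge>0. ((\<lambda>s. S s \<omega>) \<longlongrightarrow> S t \<omega>) (at_right t)"
    using S unfolding subordinator_def by blast+
  moreover have "AE \<omega> in M. B 0 \<omega> = 0" "AE \<omega> in M. continuous_on {0..} (\<lambda>t. B t \<omega>)"
    using B unfolding double_speed_BM_def by blast+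
  ultimately show ?thesis
  proof eventually_elim
    case (elim \<omega>)
    have lim: "((\<lambda>s. S s \<omega>) \<longlongrightarrow> 0) (at_right 0)"
      using elim by fastforce
    have "S s \<omega> \<in> {0..}" if "s > 0" for s
      using mono_onD[OF elim(2), of 0 s] elim(1) that by simp
    then have "\<forall>\<^sub>F s in at_right 0. S s \<omega> \<in> {0..}"
      by (auto intro: eventually_at_rightI[of 0 1])
    from continuous_on_tendsto_compose[OF elim(5) lim _ this]
    have "((\<lambda>s. B (S s \<omega>) \<omega>) \<longlongrightarrow> 0) (at_right 0)"
      using elim(4) by simp
    then have "((\<lambda>s. x + B (S s \<omega>) \<omega>) \<longlongrightarrow> x + 0) (at_right 0)"
      by (intro tendsto_intros)
    then show ?case
      by (simp add: sub_path_def[abs_def])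
  qed
qed

text \<open>Multiplying \<open>1 - c * t \<le> exp (- (c * t))\<close> by \<open>exp (c * t)\<close>
  gives a bound uniform in \<open>t\<close>, as domination requires.\<close>

lemma exp_difference_quotient_le:
  fixes c t :: real
  assumes "0 < t" "t \<le> 1"
  shows "(exp (c * t) - 1) / t \<le> \<bar>c\<bar> * exp \<bar>c\<bar>"
proof -
  have "1 + (- (c * t)) \<le> exp (- (c * t))"
    by (rule exp_ge_add_one_self)
  then have "(1 - c * t) * exp (c * t) \<le> exp (- (c * t)) * exp (c * t)"
    by (intro mult_right_mono) auto
  then have "exp (c * t) - 1 \<le> c * t * exp (c * t)"
    by (simp add: exp_minus algebra_simps)
  also have "\<dots> \<le> \<bar>c\<bar> * t * exp \<bar>c\<bar>"
  proof (rule mult_mono)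
    have "\<bar>c\<bar> * t \<le> \<bar>c\<bar>" "c * t \<le> \<bar>c\<bar> * t"
      using assms by (auto intro: mult_left_le mult_right_mono)
    then show "exp (c * t) \<le> exp \<bar>c\<bar>" "c * t \<le> \<bar>c\<bar> * t"
      by simp_all
  qed (use assms in auto)
  finally show ?thesis
    using assms by (simp add: field_simps)
qed

text \<open>From \<open>exp (c * t) \<ge> 1 + c * t\<close>; replacing \<open>1 + c * t\<close> by
  \<open>1 + c\<close> makes the negative bound independent of \<open>t\<close>.\<close>

lemma exp_difference_quotient_neg:
  fixes c t :: real
  assumes "0 < t" "t \<le> 1" "0 < c"
  shows "(exp (- c * t) - 1) / t \<le> - (c / (1 + c))"
proof -
  have pos: "0 < c * t" "0 < 1 + c * t"
    using assms by (simp_all add: add_pos_pos)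
  have "exp (- c * t) \<le> 1 / (1 + c * t)"
    using le_imp_inverse_le[OF exp_ge_add_one_self[of "c * t"]] pos
    by (simp add: exp_minus inverse_eq_divide)
  then have "exp (- c * t) - 1 \<le> 1 / (1 + c * t) - 1"
    by simp
  also have "\<dots> = - (c * t / (1 + c * t))"
    using pos by (simp add: field_simps)
  also have "\<dots> \<le> - (c * t / (1 + c))"
    using assms pos by (intro le_imp_neg_le frac_le) auto
  finally show ?thesis
    using assms by (simp add: field_simps)
qed

lemma FK_eigenpair_max_in_sublevel:
  fixes B :: "real \<Rightarrow> 'w \<Rightarrow> 'a::euclidean_space"
  assumes S: "subordinator M \<Psi> S" and B: "double_speed_BM M B"
    and FK: "FK_eigenpair M S B D V lam \<phi>"
    and "open D" and V: "continuous_on D V" and bdd: "\<And>y. y \<in> D \<Longrightarrow> b \<le> V y"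
    and nz: "\<exists>x. \<phi> x \<noteq> 0" and max: "\<And>y. \<bar>\<phi> y\<bar> \<le> \<bar>\<phi> x\<bar>"
  shows "x \<in> sublevel D V lam"
proof -
  interpret prob_space M
    using S by (simp add: subordinator_def)
  interpret C: prob_space "completion M"
    by (rule prob_space_completion)
  have pos: "0 < \<bar>\<phi> x\<bar>"
    using nz max by (metis abs_ge_zero abs_le_zero_iff less_eq_real_def)
  have "x \<in> D"
    using FK pos by (auto simp: FK_eigenpair_def)
  moreover have "V x \<le> lam"
  proof (rule ccontr)
    assume "\<not> V x \<le> lam"
    \<comment> \<open>Half the gap, so that by continuity \<open>V\<close> still exceeds
      \<open>lam + \<delta>\<close> near \<open>x\<close>.\<close>
    define \<delta> where "\<delta> = (V x - lam) / 2"
    have "\<delta> > 0" "lam + \<delta> < V x"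
      using \<open>\<not> V x \<le> lam\<close> by (auto simp: \<delta>_def field_simps)
    define \<kappa> where "\<kappa> = \<delta> / (1 + \<delta>)"
    have "\<kappa> > 0"
      using \<open>\<delta> > 0\<close> by (simp add: \<kappa>_def)
    define C where "C = \<bar>lam - b\<bar> * exp \<bar>lam - b\<bar>"
    define t where "t n = inverse (real (Suc n))" for n
    have t: "0 < t n" "t n \<le> 1" for n
      by (auto simp: t_def field_simps)
    define f where "f n \<omega> = killing_factor V (sub_path S B x \<omega>) (t n) *
      \<phi> (sub_path S B x \<omega> (t n)) *
      indicator {\<omega>. ereal (t n) < exit_time D (sub_path S B x \<omega>)} \<omega>" for n \<omega>
    have rep: "\<phi> x = exp (lam * t n) * integral\<^sup>L (completion M) (f n)" for n
      using FK \<open>x \<in> D\<close> t(1)[of n] unfolding FK_eigenpair_def f_def by force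
    \<comment> \<open>A non-integrable \<open>f n\<close> would have integral 0 by convention,
      forcing \<open>\<phi> x = 0\<close>. This also settles the measurability of the survival
      event.\<close>
    have int_f: "integrable (completion M) (f n)" for n
      using rep[of n] pos not_integrable_integral_eq[of "completion M" "f n"] by force
    \<comment> \<open>The constant \<open>c\<close> stays free: below it is \<open>b\<close> for all
      paths, and \<open>lam + \<delta>\<close> for a path at small times.\<close>
    have f_bound: "\<bar>f n \<omega>\<bar> \<le> exp (- c * t n) * \<bar>\<phi> x\<bar>"
      if "\<And>s. 0 < s \<Longrightarrow> s \<le> t n \<Longrightarrow> sub_path S B x \<omega> s \<in> D \<Longrightarrow> c \<le> V (sub_path S B x \<omega> s)"
      for n \<omega> c
    proof (cases "ereal (t n) < exit_time D (sub_path S B x \<omega>)")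
      case True
      then have "killing_factor V (sub_path S B x \<omega>) (t n) \<le> exp (- c * t n)"
        using t(1)[of n] that less_exit_time_imp_mem[OF True] by (intro killing_factor_le) auto
      then show ?thesis
        using True max killing_factor_nonneg[of V "sub_path S B x \<omega>" "t n"]
        by (auto simp: f_def abs_mult intro!: mult_mono)
    qed (simp add: f_def)
    define g where "g n \<omega> = (exp (lam * t n) * \<bar>f n \<omega>\<bar> / \<bar>\<phi> x\<bar> - 1) / t n" for n \<omega>
    have g_bound: "g n \<omega> \<le> (exp ((lam - c) * t n) - 1) / t n"
      if "\<And>s. 0 < s \<Longrightarrow> s \<le> t n \<Longrightarrow> sub_path S B x \<omega> s \<in> D \<Longrightarrow> c \<le> V (sub_path S B x \<omega> s)"
      for n \<omega> c
    proof -
      have "exp (lam * t n) * \<bar>f n \<omega>\<bar> \<le> exp (lam * t n) * (exp (- c * t n) * \<bar>\<phi> x\<bar>)"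
        using f_bound[OF that] by (intro mult_left_mono) auto
      also have "\<dots> = exp ((lam - c) * t n) * \<bar>\<phi> x\<bar>"
        by (simp add: exp_add[symmetric] algebra_simps flip: mult.assoc)
      finally have "exp (lam * t n) * \<bar>f n \<omega>\<bar> / \<bar>\<phi> x\<bar> \<le> exp ((lam - c) * t n)"
        using pos by (simp add: pos_divide_le_eq)
      then show ?thesis
        unfolding g_def using t(1)[of n] by (intro divide_right_mono) auto
    qed
    have g_le: "g n \<omega> \<le> C" for n \<omega>
      using g_bound[of n \<omega> b] bdd exp_difference_quotient_le[OF t, of "lam - b" n]
      unfolding C_def by (meson order_trans)
    have int_g: "integrable (completion M) (g n)" for n
      unfolding g_def using int_f by auto
    \<comment> \<open>Take absolute values in the representation of \<open>\<phi> x\<close> and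
      divide by \<open>\<bar>\<phi> x\<bar>\<close>.\<close>
    have int_g_ge: "0 \<le> integral\<^sup>L (completion M) (g n)" for n
    proof -
      have "\<bar>\<phi> x\<bar> \<le> exp (lam * t n) * integral\<^sup>L (completion M) (\<lambda>\<omega>. \<bar>f n \<omega>\<bar>)"
        using integral_abs_bound[of "completion M" "f n"] by (subst rep[of n]) (simp add: abs_mult)
      then have "0 \<le> (exp (lam * t n) * integral\<^sup>L (completion M) (\<lambda>\<omega>. \<bar>f n \<omega>\<bar>) / \<bar>\<phi> x\<bar> - 1) / t n"
        using pos t(1)[of n] by (simp add: pos_le_divide_eq)
      also have "\<dots> = integral\<^sup>L (completion M) (g n)"
        unfolding g_def using int_f[of n] C.prob_space by simp
      finally show ?thesis .
    qed
    \<comment> \<open>On paths that have left \<open>D\<close>, \<open>g n\<close> equals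
      \<open>- 1 / t n\<close>, so it has no uniform lower bound. Truncating at
      \<open>- \<kappa>\<close> supplies one, can only raise the integral, and makes
      \<open>h n\<close> almost surely eventually equal to \<open>- \<kappa>\<close>.\<close>
    define h where "h n \<omega> = max (g n \<omega>) (- \<kappa>)" for n \<omega>
    have "AE \<omega> in M. (\<lambda>n. h n \<omega>) \<longlonglongrightarrow> - \<kappa>"
      using AE_sub_path_tendsto[OF S B, of x]
    proof eventually_elim
      case (elim \<omega>)
      have "isCont V x"
        using V \<open>open D\<close> \<open>x \<in> D\<close> continuous_on_eq_continuous_at by blast
      then have "((\<lambda>s. V (sub_path S B x \<omega> s)) \<longlongrightarrow> V x) (at_right 0)"
        using elim by (rule isCont_tendsto_compose)
      then have "\<forall>\<^sub>F s in at_right 0. lam + \<delta> < V (sub_path S B x \<omega> s)"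
        using \<open>lam + \<delta> < V x\<close> by (rule order_tendstoD)
      then obtain e where "e > 0" and e: "\<And>s. 0 < s \<Longrightarrow> s < e \<Longrightarrow> lam + \<delta> < V (sub_path S B x \<omega> s)"
        unfolding eventually_at_right_field by auto
      have "t \<longlonglongrightarrow> 0"
        unfolding t_def by (rule LIMSEQ_inverse_real_of_nat)
      then have "\<forall>\<^sub>F n in sequentially. t n < e"
        using \<open>e > 0\<close> by (rule order_tendstoD)
      then have "\<forall>\<^sub>F n in sequentially. h n \<omega> = - \<kappa>"
      proof eventually_elim
        case (elim n)
        have "g n \<omega> \<le> (exp ((lam - (lam + \<delta>)) * t n) - 1) / t n"
          using e elim by (intro g_bound) (meson less_eq_real_def order_le_less_trans)
        also have "\<dots> \<le> - \<kappa>"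
          using exp_difference_quotient_neg[OF t \<open>\<delta> > 0\<close>, of n] by (simp add: \<kappa>_def)
        finally show ?case
          by (simp add: h_def)
      qed
      then show ?case
        by (rule tendsto_eventually)
    qed
    then have lim: "AE \<omega> in completion M. (\<lambda>n. h n \<omega>) \<longlonglongrightarrow> - \<kappa>"
      by (rule AE_completion)
    have int_h: "integrable (completion M) (h n)" for n
      unfolding h_def using int_g by auto
    have "(\<lambda>n. integral\<^sup>L (completion M) (h n)) \<longlonglongrightarrow> integral\<^sup>L (completion M) (\<lambda>_. - \<kappa>)"
    proof (rule integral_dominated_convergence[where w = "\<lambda>_. max \<bar>C\<bar> \<kappa>"])
      show "h n \<in> borel_measurable (completion M)" for n
        using int_h by auto
      show "AE \<omega> in completion M. norm (h n \<omega>) \<le> max \<bar>C\<bar> \<kappa>" for n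
      proof (rule AE_I2)
        fix \<omega>
        show "norm (h n \<omega>) \<le> max \<bar>C\<bar> \<kappa>"
          using g_le[of n \<omega>] \<open>\<kappa> > 0\<close> by (auto simp: h_def)
      qed
    qed (use lim in auto)
    moreover have "0 \<le> integral\<^sup>L (completion M) (h n)" for n
      using int_g_ge[of n] integral_mono[OF int_g[of n] int_h[of n]] by (fastforce simp: h_def)
    ultimately have "0 \<le> integral\<^sup>L (completion M) (\<lambda>_. - \<kappa>)"
      by (intro LIMSEQ_le_const) auto
    then show False
      using \<open>\<kappa> > 0\<close> C.prob_space by simp
  qed
  ultimately show ?thesis
    by (simp add: sublevel_def)
qed

text \<open>A ray from \<open>y\<close> pointing away from \<open>x\<close> never gets closer to
  \<open>x\<close> than \<open>y\<close> is. It is connected, starts in \<open>U\<close> and must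
  leave the bounded set \<open>U\<close>, so it meets the frontier.\<close>

lemma bounded_imp_frontier_point_beyond:
  fixes U :: "'a::euclidean_space set"
  assumes "bounded U" "y \<in> U"
  shows "\<exists>z\<in>frontier U. dist x y \<le> dist x z"
proof -
  \<comment> \<open>If \<open>x = y\<close>, any nonzero direction serves; otherwise take
    \<open>y - x\<close>.\<close>
  obtain v :: 'a where v: "v \<noteq> 0" "\<And>s. 0 \<le> s \<Longrightarrow> dist x y \<le> dist x (y + s *\<^sub>R v)"
  proof (cases "x = y")
    case True
    then show ?thesis
      using that nonzero_Basis nonempty_Basis by (metis all_not_in_conv dist_self zero_le_dist)
  next
    case False
    show ?thesis
    proof (rule that)
      fix s :: real assume "0 \<le> s"
      have "dist x (y + s *\<^sub>R (y - x)) = norm ((1 + s) *\<^sub>R (x - y))"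
        by (simp add: dist_norm algebra_simps)
      also have "\<dots> = (1 + s) * dist x y"
        using \<open>0 \<le> s\<close> by (simp add: dist_norm)
      finally show "dist x y \<le> dist x (y + s *\<^sub>R (y - x))"
        using \<open>0 \<le> s\<close> by (simp add: algebra_simps)
    qed (use False in simp)
  qed
  let ?T = "(\<lambda>s. y + s *\<^sub>R v) ` {0..}"
  have "connected ?T"
    by (intro connected_continuous_image continuous_intros) auto
  moreover have "?T \<inter> U \<noteq> {}"
    using \<open>y \<in> U\<close> by (auto intro!: exI[of _ 0])
  moreover have "\<not> ?T \<subseteq> U"
  proof
    assume "?T \<subseteq> U"
    obtain c where c: "\<And>z. z \<in> U \<Longrightarrow> norm (z - y) \<le> c"
      using \<open>bounded U\<close> by (metis bounded_iff bounded_translation_minus image_eqI)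
    have "norm (y - y) \<le> c"
      using \<open>y \<in> U\<close> by (rule c)
    then have "0 \<le> (c + 1) / norm v"
      by simp
    \<comment> \<open>This point of the ray lies at distance \<open>c + 1\<close> from
      \<open>y\<close>, beyond the bound \<open>c\<close>.\<close>
    then have "y + ((c + 1) / norm v) *\<^sub>R v \<in> U"
      using \<open>?T \<subseteq> U\<close> by auto
    from c[OF this] show False
      using \<open>v \<noteq> 0\<close> \<open>norm (y - y) \<le> c\<close> by simp
  qed
  ultimately obtain z where "z \<in> ?T" "z \<in> frontier U"
    using connected_Int_frontier[of ?T U] by blast
  then show ?thesis
    using v(2) by auto
qed

theorem theorem4p1:
  fixes M :: "'w measure"
    and \<Psi> :: "real \<Rightarrow> real"
    and S :: "real \<Rightarrow> 'w \<Rightarrow> real"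
    and B :: "real \<Rightarrow> 'w \<Rightarrow> 'a::euclidean_space"
    and D :: "'a set"
    and V \<phi> :: "'a \<Rightarrow> real"
    and lam :: real
    and xhat xstar :: 'a
  assumes "bernstein0 \<Psi>"
    and "subordinator M \<Psi> S" "double_speed_BM M B" "indep_processes M S B"
    and "D = UNIV \<or> (bounded D \<and> convex D \<and> open D)"
    and "convex_on D V" "ray_increasing_on D xhat V"
    and "xhat \<in> D" "\<forall>y\<in>D. V xhat \<le> V y"
    and "FK_eigenpair M S B D V lam \<phi>"
    and "\<exists>x. \<phi> x \<noteq> 0"
    and "\<forall>z\<in>frontier D. (\<phi> \<longlongrightarrow> 0) (at z)"
    and "\<forall>y. \<bar>\<phi> y\<bar> \<le> \<bar>\<phi> xstar\<bar>"
  shows "xstar \<in> sublevel D V lam \<and>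
    (bounded (sublevel D V lam) \<longrightarrow>
      (\<exists>z\<in>frontier (sublevel D V lam).
         (\<forall>w\<in>frontier (sublevel D V lam). dist xstar w \<le> dist xstar z) \<and>
         dist xstar xhat \<le> dist xstar z))"
proof (intro conjI impI)
  let ?U = "sublevel D V lam"
  have "open D"
    using assms(5) by auto
  then have "continuous_on D V"
    using assms(6) by (rule convex_on_continuous)
  then show xstar: "xstar \<in> ?U"
    using FK_eigenpair_max_in_sublevel[OF assms(2,3,10) \<open>open D\<close> _ _ assms(11)] assms(9,13)
    by blast
  assume "bounded ?U"
  have "xhat \<in> ?U"
    using xstar assms(8,9) by (auto simp: sublevel_def intro: order_trans)
  with \<open>bounded ?U\<close> obtain y where y: "y \<in> frontier ?U" "dist xstar xhat \<le> dist xstar y"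
    using bounded_imp_frontier_point_beyond by blast
  \<comment> \<open>Compactness ensures that the maximum over the frontier is attained; it dominates
    the distance to \<open>y\<close>.\<close>
  have "compact (frontier ?U)"
    using \<open>bounded ?U\<close> by (rule compact_frontier_bounded)
  moreover have "continuous_on (frontier ?U) (dist xstar)"
    by (intro continuous_intros)
  ultimately obtain z where "z \<in> frontier ?U" "\<forall>w\<in>frontier ?U. dist xstar w \<le> dist xstar z"
    using y(1) continuous_attains_sup by blast
  then show "\<exists>z\<in>frontier ?U. (\<forall>w\<in>frontier ?U. dist xstar w \<le> dist xstar z) \<and>
      dist xstar xhat \<le> dist xstar z"
    using y by (meson order_trans)
qed

end
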